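(* Let $n\ge 1$ and let $\pi\in S_n$. The inversion graph $G_\pi$ is a tree if and only if $\pi$ is a unimodal cycle of $[n]=\{1,\dots,n\}$.
   Context: Inversion graph: $G_\pi$ is the simple graph with vertex set $[n]$ (the values of $\pi$) in which values $a<b$ are adjacent if and only if $b$ appears to the left of $a$ in the one-line notation $\pi(1)\cdots\pi(n)$, i.e. $\pi^{-1}(b)<\pi^{-1}(a)$. Unimodal cycle: $\pi$ is a unimodal cycle of $[n]$ if it can be written as a single cycle $(c_1,\dots,c_n)$ on all of $[n]$ (mapping $c_i\mapsto c_{i+1}$, indices cyclic) whose entries, after cyclic rotation, strictly increase to a maximum and then strictly decrease. Equivalently, for $n\ge 2$, the cycle has the form $(u_1,\dots,u_r,n,d_1,\dots,d_s,1)$ with $u_1<\cdots<u_r<n$ and $n>d_1>\cdots>d_s>1$, where $r=0$ and $s=0$ are allowed; for $n=1$ the singleton cycle $(1)$ is a unimodal cycle. *)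

theory Defs
  imports "Graph_Theory.Graph_Theory" "HOL-Combinatorics.Cycles"
begin

text \<open>
  A simple graph is a symmetric loop-free digraph (\<open>pair_graph\<close>), in which every
  edge \<open>{a, b}\<close> yields the two arcs \<open>(a, b)\<close> and \<open>(b, a)\<close>. The one-line notation of
  \<open>\<pi>\<close> has the value \<open>v\<close> at position \<open>inv \<pi> v\<close>.
\<close>

definition inversion_graph :: "nat \<Rightarrow> (nat \<Rightarrow> nat) \<Rightarrow> nat pair_pre_digraph" where
  "inversion_graph n \<pi> =
     \<lparr> pverts = {1..n},
       parcs = {(u, v). u \<in> {1..n} \<and> v \<in> {1..n} \<and>
         ((u < v \<and> inv \<pi> v < inv \<pi> u) \<or> (v < u \<and> inv \<pi> u < inv \<pi> v))} \<rparr>"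

lemma pair_graph_inversion_graph: "pair_graph (inversion_graph n \<pi>)"
proof
  show "finite (parcs (inversion_graph n \<pi>))"
    by (rule finite_subset[of _ "{1..n} \<times> {1..n}"]) (auto simp: inversion_graph_def)
  show "symmetric (with_proj (inversion_graph n \<pi>))"
    by (auto simp: symmetric_def inversion_graph_def intro!: symI)
qed (auto simp: inversion_graph_def)

text \<open>
  The constant \<open>tree\<close> of the digraph library is not the notion for undirected graphs: it
  forbids every directed cycle, and in a symmetric digraph each edge is traversed back and
  forth by a directed cycle of length 2. The cycles of the undirected graph are the directed
  cycles of length at least 3.
\<close>

definition graph_tree :: "'a pair_pre_digraph \<Rightarrow> bool" where
  "graph_tree G \<longleftrightarrow> pair_graph G \<and> connected (with_proj G) \<and>
     \<not> (\<exists>p. pre_digraph.cycle (with_proj G) p \<and> 3 \<le> length p)"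

definition unimodal :: "nat list \<Rightarrow> bool" where
  "unimodal xs \<longleftrightarrow> (\<exists>us m ds. xs = us @ m # ds \<and>
     sorted_wrt (<) (us @ [m]) \<and> sorted_wrt (>) (m # ds))"

text \<open>
  For \<open>cs = [c\<^sub>1, \<dots>, c\<^sub>n]\<close> with distinct entries, \<open>cycle_of_list cs\<close> maps
  \<open>c\<^sub>i\<close> to \<open>c\<^sub>i\<^sub>+\<^sub>1\<close> and \<open>c\<^sub>n\<close> to \<open>c\<^sub>1\<close>.
\<close>

definition unimodal_cycle :: "nat \<Rightarrow> (nat \<Rightarrow> nat) \<Rightarrow> bool" where
  "unimodal_cycle n \<pi> \<longleftrightarrow> (\<exists>cs. distinct cs \<and> set cs = {1..n} \<and>
     \<pi> = cycle_of_list cs \<and> (\<exists>k. unimodal (rotate k cs)))"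

end

theory Submission
  imports Defs
begin

text \<open>
  Both properties satisfy the same recursion on \<open>n\<close>. With \<open>\<tau>\<close> the transposition of \<open>n\<close> and
  \<open>n + 1\<close>, a permutation of \<open>{1..n + 1}\<close> has the property iff it is \<open>\<sigma> \<circ> \<tau>\<close> or \<open>\<tau> \<circ> \<sigma>\<close> for a
  permutation \<open>\<sigma>\<close> of \<open>{1..n}\<close> that has it. Since both hold for the identity of \<open>{1}\<close>, they
  are equivalent. (The permutations that the recursion generates are the Coxeter elements of
  the symmetric group: the products of all the adjacent transpositions, each taken once.)

  For trees (\<open>tree_inversion_graph_Suc_iff\<close>), the passage from \<open>\<sigma>\<close> to \<open>\<sigma> \<circ> \<tau>\<close> or \<open>\<tau> \<circ> \<sigma>\<close>
  attaches a leaf to the inversion graph, up to a renaming of vertices, and a leaf does not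
  affect being a tree (\<open>graph_tree_add_leaf_iff\<close>). Every permutation \<open>\<pi>\<close> whose graph is a
  tree arises in this way: \<open>\<pi> \<circ> \<tau>\<close> fixes \<open>n + 1\<close> if \<open>n + 1\<close> is the second to last entry of
  \<open>\<pi>\<close>, \<open>\<tau> \<circ> \<pi>\<close> fixes \<open>n + 1\<close> if \<open>n\<close> is the last entry, and otherwise the graph is
  disconnected or has a triangle or a square (\<open>tree_inversion_graph_max_near_end\<close>).

  For unimodal cycles (\<open>unimodal_cycle_Suc_iff\<close>), the two compositions insert \<open>n + 1\<close> right
  after and right before \<open>n\<close> in the cycle. A unimodal list stays unimodal when a new maximum
  is inserted next to the old one, and in a unimodal list the two largest entries are
  neighbours, so that each cycle for \<open>n + 1\<close> comes from one for \<open>n\<close>.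
\<close>

section \<open>Trees in terms of vertex lists\<close>

text \<open>
  The indices are cyclic and the first vertex is not repeated at the end, so that no vertex of
  the cycle is special: each has a predecessor and a successor in the list.
\<close>

definition vertex_cycle :: "'a rel \<Rightarrow> 'a list \<Rightarrow> bool" where
  "vertex_cycle E vs \<longleftrightarrow> 3 \<le> length vs \<and> distinct vs \<and>
     (\<forall>i<length vs. (vs ! i, vs ! (Suc i mod length vs)) \<in> E)"

lemma pcas_conv_nth:
  assumes "p \<noteq> []"
  shows "pcas u p v \<longleftrightarrow> fst (hd p) = u \<and> snd (last p) = v \<and>
     (\<forall>i. Suc i < length p \<longrightarrow> snd (p ! i) = fst (p ! Suc i))"
  using assms
proof (induction p arbitrary: u)
  case (Cons e p)
  show ?case
  proof (cases p)
    case (Cons e' p')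
    have "(\<forall>i. Suc i < length (e # p) \<longrightarrow> snd ((e # p) ! i) = fst ((e # p) ! Suc i)) \<longleftrightarrow>
      snd e = fst e' \<and> (\<forall>i. Suc i < length p \<longrightarrow> snd (p ! i) = fst (p ! Suc i))"
      (is "?L \<longleftrightarrow> ?R")
    proof
      assume ?L
      then show ?R using Cons by force
    next
      assume ?R
      show ?L
      proof (intro allI impI)
        fix i assume "Suc i < length (e # p)"
        then show "snd ((e # p) ! i) = fst ((e # p) ! Suc i)"
          using \<open>?R\<close> Cons by (cases i) auto
      qed
    qed
    moreover have "pcas (snd e) p v \<longleftrightarrow> snd e = fst e' \<and> snd (last p) = v \<and>
        (\<forall>i. Suc i < length p \<longrightarrow> snd (p ! i) = fst (p ! Suc i))"
      using Cons.IH[of "snd e"] Cons by (simp add: eq_commute)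
    moreover have "last (e # p) = last p" using Cons by simp
    ultimately show ?thesis by (simp only: pcas.simps list.sel) blast
  qed auto
qed simp

lemma pawalk_verts_if_pcas: "pcas u p v \<Longrightarrow> pawalk_verts u p = u # map snd p"
  by (induction p arbitrary: u) auto

text \<open>
  A closed walk is determined by the heads of its arcs, because each arc starts where the one
  before it ends, and the heads are the vertices required to be distinct on a cycle.
\<close>

lemma ex_cycle_iff_ex_vertex_cycle:
  assumes "pair_graph G"
  shows "(\<exists>p. pre_digraph.cycle (with_proj G) p \<and> 3 \<le> length p) \<longleftrightarrow>
    (\<exists>vs. vertex_cycle (parcs G) vs)"
proof
  assume "\<exists>p. pre_digraph.cycle (with_proj G) p \<and> 3 \<le> length p"
  then obtain p u where p: "set p \<subseteq> parcs G" "pcas u p u" "distinct (map snd p)" "3 \<le> length p"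
    by (auto simp: pre_digraph.cycle_def pre_digraph.awalk_def cas_with_proj_eq
        awalk_verts_with_proj_eq pawalk_verts_if_pcas)
  then have "p \<noteq> []" by auto
  have closed: "fst (p ! 0) = snd (p ! (length p - 1))"
    and consec: "\<And>i. Suc i < length p \<Longrightarrow> snd (p ! i) = fst (p ! Suc i)"
    using p(2) \<open>p \<noteq> []\<close> by (auto simp: pcas_conv_nth hd_conv_nth last_conv_nth)
  have "vertex_cycle (parcs G) (map snd p)"
    unfolding vertex_cycle_def
  proof (intro conjI allI impI)
    fix i assume i: "i < length (map snd p)"
    let ?j = "Suc i mod length p"
    have "?j < length p" using \<open>p \<noteq> []\<close> by simp
    have "snd (p ! i) = fst (p ! ?j)"
    proof (cases "Suc i = length p")
      case True
      then show ?thesis using closed by (metis diff_Suc_1 mod_self)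
    next
      case False
      then show ?thesis using consec i by auto
    qed
    then show "(map snd p ! i, map snd p ! (Suc i mod length (map snd p))) \<in> parcs G"
      using p(1) i \<open>?j < length p\<close>
      by (metis length_map nth_map nth_mem prod.collapse subsetD)
  qed (use p in auto)
  then show "\<exists>vs. vertex_cycle (parcs G) vs" ..
next
  assume "\<exists>vs. vertex_cycle (parcs G) vs"
  then obtain vs where vs: "3 \<le> length vs" "distinct vs"
    and E: "\<And>i. i < length vs \<Longrightarrow> (vs ! i, vs ! (Suc i mod length vs)) \<in> parcs G"
    by (auto simp: vertex_cycle_def)
  define p where "p = map (\<lambda>i. (vs ! i, vs ! (Suc i mod length vs))) [0..<length vs]"
  have len: "length p = length vs" by (simp add: p_def)
  have "p \<noteq> []" using vs len by auto
  have "map snd p = rotate1 vs"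
    by (rule nth_equalityI) (auto simp: p_def nth_rotate1)
  moreover have "pcas (vs ! 0) p (vs ! 0)"
    using \<open>p \<noteq> []\<close> vs(1)
    by (subst pcas_conv_nth) (auto simp: p_def hd_map last_map hd_upt)
  moreover have "set p \<subseteq> parcs G" using E by (auto simp: p_def)
  moreover have "vs ! 0 \<in> pverts G"
  proof -
    interpret pair_graph G by fact
    show ?thesis using E[of 0] vs(1) in_arcsD1 by fastforce
  qed
  ultimately have "pre_digraph.cycle (with_proj G) p"
    using vs(2) \<open>p \<noteq> []\<close>
    by (auto simp: pre_digraph.cycle_def pre_digraph.awalk_def cas_with_proj_eq
        awalk_verts_with_proj_eq pawalk_verts_if_pcas intro!: exI[of _ "vs ! 0"])
  then show "\<exists>p. pre_digraph.cycle (with_proj G) p \<and> 3 \<le> length p"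
    using vs(1) len by auto
qed

lemma (in pair_wf_digraph) rtrancl_on_pverts_iff:
  assumes "u \<in> pverts G"
  shows "(u, v) \<in> rtrancl_on (pverts G) (parcs G) \<longleftrightarrow> (u, v) \<in> (parcs G)\<^sup>*"
proof
  show "(u, v) \<in> (parcs G)\<^sup>*" if "(u, v) \<in> rtrancl_on (pverts G) (parcs G)"
    using that
  proof induction
    case (step y z)
    then show ?case by (meson converse_rtrancl_into_rtrancl)
  qed simp
  show "(u, v) \<in> rtrancl_on (pverts G) (parcs G)" if "(u, v) \<in> (parcs G)\<^sup>*"
    using that
  proof induction
    case base
    show ?case using assms by (rule rtrancl_on_refl)
  next
    case (step y z)
    then show ?case by (meson rtrancl_on_into_rtrancl_on in_arcsD2)
  qed
qed

text \<open>
  In a symmetric digraph, connectedness of the underlying undirected graph is reachability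
  along the arcs.
\<close>

lemma graph_tree_iff:
  assumes "pair_graph G"
  shows "graph_tree G \<longleftrightarrow> pverts G \<noteq> {} \<and>
    (\<forall>u\<in>pverts G. \<forall>v\<in>pverts G. (u, v) \<in> (parcs G)\<^sup>*) \<and> (\<nexists>vs. vertex_cycle (parcs G) vs)"
proof -
  interpret pair_graph G by fact
  have "parcs (mk_symmetric (with_proj G)) = parcs G"
    using adj_mk_symmetric_eq[OF pair_sym_arcs] by simp
  then have "connected (with_proj G) \<longleftrightarrow> pverts G \<noteq> {} \<and>
      (\<forall>u\<in>pverts G. \<forall>v\<in>pverts G. (u, v) \<in> (parcs G)\<^sup>*)"
    by (auto simp: connected_def strongly_connected_def reachable_def rtrancl_on_pverts_iff)
  then show ?thesis
    using assms ex_cycle_iff_ex_vertex_cycle[OF assms] by (auto simp: graph_tree_def)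
qed

lemma vertex_cycle_map:
  assumes "vertex_cycle E vs" "inj_on f (set vs)" "\<And>u v. (u, v) \<in> E \<Longrightarrow> (f u, f v) \<in> E'"
  shows "vertex_cycle E' (map f vs)"
proof -
  have "Suc i mod length vs < length vs" if "i < length vs" for i
    using that by (intro mod_less_divisor) auto
  then show ?thesis
    using assms by (auto simp: vertex_cycle_def distinct_map)
qed

lemma vertex_cycle_subset_Domain: "vertex_cycle E vs \<Longrightarrow> set vs \<subseteq> Domain E"
  unfolding vertex_cycle_def by (metis DomainI in_set_conv_nth subsetI)

lemma vertex_cycle_triangle_iff:
  "vertex_cycle E [a, b, c] \<longleftrightarrow> distinct [a, b, c] \<and> {(a, b), (b, c), (c, a)} \<subseteq> E"
  by (auto simp: vertex_cycle_def All_less_Suc)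

lemma vertex_cycle_square_iff:
  "vertex_cycle E [a, b, c, d] \<longleftrightarrow>
    distinct [a, b, c, d] \<and> {(a, b), (b, c), (c, d), (d, a)} \<subseteq> E"
  by (auto simp: vertex_cycle_def All_less_Suc)

text \<open>
  The predecessor and the successor of a vertex on a cycle are distinct, as the cycle has at
  least three vertices.
\<close>

lemma vertex_cycle_avoids_leaf:
  assumes "vertex_cycle E vs"
    and "\<And>v. (w, v) \<in> E \<Longrightarrow> v = x" "\<And>v. (v, w) \<in> E \<Longrightarrow> v = x"
  shows "w \<notin> set vs"
proof
  assume "w \<in> set vs"
  then obtain i where i: "i < length vs" "vs ! i = w" by (auto simp: in_set_conv_nth)
  let ?l = "length vs"
  have l: "3 \<le> ?l" and dist: "distinct vs"
    and E: "\<And>i. i < ?l \<Longrightarrow> (vs ! i, vs ! (Suc i mod ?l)) \<in> E"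
    using assms(1) by (auto simp: vertex_cycle_def)
  define j where "j = (if i = 0 then ?l - 1 else i - 1)"
  define k where "k = (if Suc i = ?l then 0 else Suc i)"
  have jk: "j < ?l" "k < ?l" "j \<noteq> k" "Suc j mod ?l = i" "Suc i mod ?l = k"
    using i l by (auto simp: j_def k_def)
  have "vs ! k = x" using E[OF i(1)] jk i assms(2) by auto
  moreover have "vs ! j = x" using E[OF jk(1)] jk i assms(3) by auto
  ultimately show False using jk dist nth_eq_iff_index_eq by metis
qed

text \<open>
  A leaf \<open>w\<close> hanging from \<open>f x\<close> lies on no cycle. It does not affect connectedness either,
  since sending \<open>w\<close> to \<open>x\<close> and undoing \<open>f\<close> elsewhere retracts the walks of \<open>G\<close> to walks of
  \<open>H\<close>. The renaming \<open>f\<close> is there because the leaf to be removed from an inversion graph need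
  not be the largest value.
\<close>

lemma graph_tree_add_leaf_iff:
  assumes G: "pair_graph G" and H: "pair_graph H"
    and inj: "inj_on f (pverts H)" and w: "w \<notin> f ` pverts H" and x: "x \<in> pverts H"
    and verts: "pverts G = insert w (f ` pverts H)"
    and old: "\<And>u v. u \<in> pverts H \<Longrightarrow> v \<in> pverts H \<Longrightarrow>
      (f u, f v) \<in> parcs G \<longleftrightarrow> (u, v) \<in> parcs H"
    and new: "\<And>v. v \<in> pverts H \<Longrightarrow> (w, f v) \<in> parcs G \<longleftrightarrow> v = x"
  shows "graph_tree G \<longleftrightarrow> graph_tree H"
proof -
  interpret G: pair_graph G by fact
  interpret H: pair_graph H by fact
  have symG: "(u, v) \<in> parcs G \<Longrightarrow> (v, u) \<in> parcs G" for u v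
    using G.pair_sym_arcs by (auto simp: symmetric_def dest: symD)
  have noloop: "(w, w) \<notin> parcs G" using G.pair_no_loops by force
  have leaf: "v = f x" if "(w, v) \<in> parcs G \<or> (v, w) \<in> parcs G" for v
  proof -
    have "(w, v) \<in> parcs G" using that symG by blast
    moreover from this have "v \<in> pverts G" "v \<noteq> w" using G.in_arcsD2 noloop by auto
    ultimately show ?thesis using verts new by auto
  qed
  have wx: "(w, f x) \<in> parcs G" using new x by simp
  \<comment> \<open>\<open>g\<close> is the retraction: the inverse of \<open>f\<close>, extended to the leaf.\<close>
  define g where "g v = (if v = w then x else the_inv_into (pverts H) f v)" for v
  have gf: "g (f v) = v" if "v \<in> pverts H" for v
    using that w inj by (auto simp: g_def the_inv_into_f_f)
  have gw: "g w = x" by (simp add: g_def)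
  have g_arc: "(g u, g v) \<in> parcs H" if "(u, v) \<in> parcs G" "u \<noteq> w" "v \<noteq> w" for u v
  proof -
    from that have "u \<in> f ` pverts H" "v \<in> f ` pverts H"
      using verts G.in_arcsD1[OF that(1)] G.in_arcsD2[OF that(1)] by auto
    then show ?thesis using that old gf by auto
  qed
  have g_walk: "(g u, g v) \<in> (parcs H)\<^sup>*" if "(u, v) \<in> (parcs G)\<^sup>*" for u v
    using that
  proof induction
    case (step y z)
    have "(g y, g z) \<in> (parcs H)\<^sup>*"
    proof (cases "y = w \<or> z = w")
      case True
      then have "g y = g z" using leaf step.hyps(2) gf[OF x] gw by metis
      then show ?thesis by simp
    qed (use g_arc step.hyps(2) in auto)
    with step.IH show ?case by (rule rtrancl_trans)
  qed simp
  have f_walk: "(f u, f v) \<in> (parcs G)\<^sup>*" if "(u, v) \<in> (parcs H)\<^sup>*" "u \<in> pverts H" for u v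
    using that
  proof induction
    case (step y z)
    then show ?case
      using old H.in_arcsD1 H.in_arcsD2 by (meson rtrancl.rtrancl_into_rtrancl)
  qed simp
  have "(\<forall>u\<in>pverts G. \<forall>v\<in>pverts G. (u, v) \<in> (parcs G)\<^sup>*) \<longleftrightarrow>
        (\<forall>u\<in>pverts H. \<forall>v\<in>pverts H. (u, v) \<in> (parcs H)\<^sup>*)" (is "?L \<longleftrightarrow> ?R")
  proof
    assume ?L
    then show ?R using g_walk gf verts by (metis imageI insertCI)
  next
    assume R: ?R
    have to: "(u, f x) \<in> (parcs G)\<^sup>*" "(f x, u) \<in> (parcs G)\<^sup>*" if "u \<in> pverts G" for u
    proof -
      have "u = w \<or> (\<exists>u'\<in>pverts H. u = f u')" using that verts by auto
      then show "(u, f x) \<in> (parcs G)\<^sup>*" "(f x, u) \<in> (parcs G)\<^sup>*"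
        using wx symG[OF wx] f_walk R x by auto
    qed
    then show ?L by (meson rtrancl_trans)
  qed
  moreover have "(\<exists>vs. vertex_cycle (parcs G) vs) \<longleftrightarrow> (\<exists>vs. vertex_cycle (parcs H) vs)"
  proof
    assume "\<exists>vs. vertex_cycle (parcs G) vs"
    then obtain vs where vs: "vertex_cycle (parcs G) vs" ..
    let ?E = "{(u, v) \<in> parcs G. u \<noteq> w \<and> v \<noteq> w}"
    have "w \<notin> set vs" using vertex_cycle_avoids_leaf[OF vs, of w "f x"] leaf by blast
    have sub: "set vs \<subseteq> f ` pverts H"
    proof
      fix v assume "v \<in> set vs"
      then have "v \<in> pverts G" "v \<noteq> w"
        using vertex_cycle_subset_Domain[OF vs] \<open>w \<notin> set vs\<close> G.in_arcsD1 by blast+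
      then show "v \<in> f ` pverts H" using verts by auto
    qed
    have "vertex_cycle ?E vs"
      unfolding vertex_cycle_def
    proof (intro conjI allI impI)
      fix i assume i: "i < length vs"
      then have "Suc i mod length vs < length vs" by (intro mod_less_divisor) auto
      then have "vs ! i \<noteq> w" "vs ! (Suc i mod length vs) \<noteq> w"
        using i \<open>w \<notin> set vs\<close> nth_mem by metis+
      then show "(vs ! i, vs ! (Suc i mod length vs)) \<in> ?E"
        using vs i by (simp add: vertex_cycle_def)
    qed (use vs in \<open>auto simp: vertex_cycle_def\<close>)
    moreover have "inj_on g (set vs)"
      using gf by (intro inj_on_subset[OF _ sub]) (auto simp: inj_on_def)
    ultimately have "vertex_cycle (parcs H) (map g vs)"
      by (rule vertex_cycle_map) (use g_arc in auto)
    then show "\<exists>vs. vertex_cycle (parcs H) vs" ..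
  next
    assume "\<exists>vs. vertex_cycle (parcs H) vs"
    then obtain vs where vs: "vertex_cycle (parcs H) vs" ..
    have "set vs \<subseteq> pverts H"
      using vertex_cycle_subset_Domain[OF vs] H.in_arcsD1 by blast
    then have "vertex_cycle (parcs G) (map f vs)"
      using vertex_cycle_map[OF vs inj_on_subset[OF inj]] old H.in_arcsD1 H.in_arcsD2 by blast
    then show "\<exists>vs. vertex_cycle (parcs G) vs" ..
  qed
  ultimately show ?thesis
    unfolding graph_tree_iff[OF G] graph_tree_iff[OF H] using verts x by auto
qed

section \<open>Trees among the inversion graphs\<close>

lemma pverts_inversion_graph [simp]: "pverts (inversion_graph n \<pi>) = {1..n}"
  by (simp add: inversion_graph_def)

lemma parcs_inversion_graph:
  "(u, v) \<in> parcs (inversion_graph n \<pi>) \<longleftrightarrow> u \<in> {1..n} \<and> v \<in> {1..n} \<and>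
     ((u < v \<and> inv \<pi> v < inv \<pi> u) \<or> (v < u \<and> inv \<pi> u < inv \<pi> v))"
  by (simp add: inversion_graph_def)

text \<open>
  Composition on the right swaps the last two entries of \<open>\<sigma> 1, \<dots>, \<sigma> n, n + 1\<close>. Then \<open>\<sigma> n\<close> is
  the only entry to the right of \<open>n + 1\<close>, and the values up to \<open>n\<close> keep their relative order:
  \<open>n + 1\<close> is a leaf attached to \<open>\<sigma> n\<close>.
\<close>

lemma graph_tree_comp_transpose_iff:
  fixes n :: nat and \<sigma> :: "nat \<Rightarrow> nat"
  assumes \<sigma>: "\<sigma> permutes {1..n}" and n: "1 \<le> n"
  shows "graph_tree (inversion_graph (Suc n) (\<sigma> \<circ> transpose n (Suc n))) \<longleftrightarrow>
    graph_tree (inversion_graph n \<sigma>)"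
proof (rule graph_tree_add_leaf_iff[where f = id and w = "Suc n" and x = "\<sigma> n"])
  have inv: "inv (\<sigma> \<circ> transpose n (Suc n)) = transpose n (Suc n) \<circ> inv \<sigma>"
    using \<sigma> by (simp add: o_inv_distrib permutes_bij)
  have range: "inv \<sigma> v \<in> {1..n} \<longleftrightarrow> v \<in> {1..n}" for v
    using permutes_in_image[OF permutes_inv[OF \<sigma>]] .
  have top: "inv \<sigma> (Suc n) = Suc n" using permutes_not_in[OF permutes_inv[OF \<sigma>]] by simp
  have mono: "transpose n (Suc n) i < transpose n (Suc n) j \<longleftrightarrow> i < j"
    if "i \<in> {1..n}" "j \<in> {1..n}" for i j
    using that by (auto simp: transpose_def)
  show "(id u, id v) \<in> parcs (inversion_graph (Suc n) (\<sigma> \<circ> transpose n (Suc n))) \<longleftrightarrow>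
      (u, v) \<in> parcs (inversion_graph n \<sigma>)"
    if "u \<in> pverts (inversion_graph n \<sigma>)" "v \<in> pverts (inversion_graph n \<sigma>)" for u v
    using that range[of u] range[of v] by (simp add: parcs_inversion_graph inv mono)
  show "(Suc n, id v) \<in> parcs (inversion_graph (Suc n) (\<sigma> \<circ> transpose n (Suc n))) \<longleftrightarrow> v = \<sigma> n"
    if "v \<in> pverts (inversion_graph n \<sigma>)" for v
  proof -
    have "inv \<sigma> v \<in> {1..n}" using that range by simp
    then have "n < transpose n (Suc n) (inv \<sigma> v) \<longleftrightarrow> inv \<sigma> v = n"
      by (auto simp: transpose_def)
    also have "\<dots> \<longleftrightarrow> v = \<sigma> n" using permutes_inv_eq[OF \<sigma>] by auto
    finally show ?thesis using that by (auto simp: parcs_inversion_graph inv top)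
  qed
  show "\<sigma> n \<in> pverts (inversion_graph n \<sigma>)" using permutes_in_image[OF \<sigma>] n by auto
qed (auto simp: pair_graph_inversion_graph)

text \<open>
  Composition on the left swaps the values \<open>n\<close> and \<open>n + 1\<close> in \<open>\<sigma> 1, \<dots>, \<sigma> n, n + 1\<close>. Now
  \<open>n + 1\<close> plays the part that \<open>n\<close> has in \<open>\<sigma>\<close>, and \<open>n\<close> stands last, where it forms inversions
  with the larger values only: \<open>n\<close> is a leaf attached to \<open>n + 1\<close>.
\<close>

lemma graph_tree_transpose_comp_iff:
  fixes n :: nat and \<sigma> :: "nat \<Rightarrow> nat"
  assumes \<sigma>: "\<sigma> permutes {1..n}" and n: "1 \<le> n"
  shows "graph_tree (inversion_graph (Suc n) (transpose n (Suc n) \<circ> \<sigma>)) \<longleftrightarrow>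
    graph_tree (inversion_graph n \<sigma>)"
proof (rule graph_tree_add_leaf_iff[where f = "transpose n (Suc n)" and w = n and x = n])
  let ?t = "transpose n (Suc n)"
  have inv: "inv (?t \<circ> \<sigma>) = inv \<sigma> \<circ> ?t"
    using \<sigma> by (simp add: o_inv_distrib permutes_bij)
  have range: "inv \<sigma> v \<in> {1..n} \<longleftrightarrow> v \<in> {1..n}" for v
    using permutes_in_image[OF permutes_inv[OF \<sigma>]] .
  have top: "inv \<sigma> (Suc n) = Suc n" using permutes_not_in[OF permutes_inv[OF \<sigma>]] by simp
  have mono: "?t i < ?t j \<longleftrightarrow> i < j" if "i \<in> {1..n}" "j \<in> {1..n}" for i j
    using that by (auto simp: transpose_def)
  have in_range: "?t i \<in> {1..Suc n}" if "i \<in> {1..n}" for i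
    using that by (auto simp: transpose_def)
  show "(?t u, ?t v) \<in> parcs (inversion_graph (Suc n) (?t \<circ> \<sigma>)) \<longleftrightarrow>
      (u, v) \<in> parcs (inversion_graph n \<sigma>)"
    if "u \<in> pverts (inversion_graph n \<sigma>)" "v \<in> pverts (inversion_graph n \<sigma>)" for u v
    using that in_range[of u] in_range[of v] by (simp add: parcs_inversion_graph inv mono)
  show "(n, ?t v) \<in> parcs (inversion_graph (Suc n) (?t \<circ> \<sigma>)) \<longleftrightarrow> v = n"
    if "v \<in> pverts (inversion_graph n \<sigma>)" for v
    using that range[of v] n
    by (auto simp: parcs_inversion_graph inv top transpose_def)
  show "pverts (inversion_graph (Suc n) (?t \<circ> \<sigma>)) =
      insert n (?t ` pverts (inversion_graph n \<sigma>))"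
  proof (intro equalityI subsetI)
    fix v assume v: "v \<in> pverts (inversion_graph (Suc n) (?t \<circ> \<sigma>))"
    show "v \<in> insert n (?t ` pverts (inversion_graph n \<sigma>))"
    proof (cases "v = n")
      case False
      then have "?t v \<in> {1..n}" using v n by (auto simp: transpose_def)
      then show ?thesis by (intro insertI2 image_eqI[of v ?t "?t v"]) auto
    qed simp
  qed (use n in_range in auto)
qed (use n in \<open>auto simp: pair_graph_inversion_graph transpose_def split: if_splits\<close>)

text \<open>
  The entry \<open>n + 1\<close> is not last, for it would be isolated. If it has at least two entries to its
  right, consider the last two of them, \<open>\<pi> n\<close> and \<open>\<pi> (n + 1)\<close>. They increase, as otherwise
  they form a triangle with \<open>n + 1\<close>. If \<open>n\<close> is not the last entry, it is neither of the two. To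
  the right of \<open>n + 1\<close> it would form a triangle with \<open>n + 1\<close> and the last entry; to the left of
  \<open>n + 1\<close>, both \<open>n\<close> and \<open>n + 1\<close> are adjacent to both of the last two entries, and this is a
  square.
\<close>

lemma tree_inversion_graph_max_near_end:
  fixes n :: nat and \<pi> :: "nat \<Rightarrow> nat"
  assumes \<pi>: "\<pi> permutes {1..Suc n}" and n: "1 \<le> n"
    and tree: "graph_tree (inversion_graph (Suc n) \<pi>)"
  shows "\<pi> n = Suc n \<or> \<pi> (Suc n) = n"
proof (rule ccontr)
  assume not: "\<not> ?thesis"
  let ?G = "inversion_graph (Suc n) \<pi>"
  have conn: "(u, v) \<in> (parcs ?G)\<^sup>*" if "u \<in> {1..Suc n}" "v \<in> {1..Suc n}" for u v
    using tree that unfolding graph_tree_iff[OF pair_graph_inversion_graph] by auto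
  have acyclic: "\<not> vertex_cycle (parcs ?G) vs" for vs
    using tree unfolding graph_tree_iff[OF pair_graph_inversion_graph] by auto
  have range: "\<pi> i \<in> {1..Suc n} \<longleftrightarrow> i \<in> {1..Suc n}" for i using permutes_in_image[OF \<pi>] .
  have inj: "\<pi> i = \<pi> j \<longleftrightarrow> i = j" for i j using permutes_inj[OF \<pi>] by (auto dest: injD)
  have inversion: "(\<pi> i, \<pi> j) \<in> parcs ?G \<and> (\<pi> j, \<pi> i) \<in> parcs ?G"
    if "i < j" "\<pi> j < \<pi> i" "i \<in> {1..Suc n}" "j \<in> {1..Suc n}" for i j
    using that range[of i] range[of j] permutes_inverses(2)[OF \<pi>]
    by (auto simp: parcs_inversion_graph)
  have no_321: False
    if "i < j" "j < k" "\<pi> k < \<pi> j" "\<pi> j < \<pi> i" "i \<in> {1..Suc n}" "k \<in> {1..Suc n}" for i j k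
  proof -
    have "vertex_cycle (parcs ?G) [\<pi> i, \<pi> j, \<pi> k]"
      using that inversion[of i j] inversion[of j k] inversion[of i k]
      by (simp add: vertex_cycle_triangle_iff)
    then show False using acyclic by blast
  qed
  have no_3412: False
    if "i < j" "j < k" "k < l" "\<pi> k < \<pi> l" "\<pi> l < \<pi> i" "\<pi> i < \<pi> j"
      "i \<in> {1..Suc n}" "l \<in> {1..Suc n}" for i j k l
  proof -
    have "vertex_cycle (parcs ?G) [\<pi> i, \<pi> k, \<pi> j, \<pi> l]"
      using that inversion[of i k] inversion[of j k] inversion[of i l] inversion[of j l]
      by (simp add: vertex_cycle_square_iff)
    then show False using acyclic by blast
  qed
  define p where "p = inv \<pi> (Suc n)"
  define q where "q = inv \<pi> n"
  have p: "\<pi> p = Suc n" and q: "\<pi> q = n"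
    using permutes_inverses(1)[OF \<pi>] by (auto simp: p_def q_def)
  have pr: "p \<in> {1..Suc n}" and qr: "q \<in> {1..Suc n}"
    using range[of p] range[of q] p q n by auto
  have "p \<noteq> Suc n"
  proof
    assume last: "p = Suc n"
    have "(Suc n, 1) \<in> (parcs ?G)\<^sup>*" using conn n by auto
    then obtain v where "(Suc n, v) \<in> parcs ?G" using n by (auto elim: converse_rtranclE)
    then have "v \<in> {1..Suc n}" "Suc n < inv \<pi> v"
      using last unfolding p_def by (auto simp: parcs_inversion_graph)
    then show False using permutes_in_image[OF permutes_inv[OF \<pi>], of v] by auto
  qed
  moreover have "p \<noteq> n" using not p by auto
  ultimately have "p < n" using pr by auto
  have y: "\<pi> (Suc n) < n"
    using not range[of "Suc n"] inj[of "Suc n" p] p \<open>p \<noteq> Suc n\<close> by auto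
  have x: "\<pi> n < Suc n" using range[of n] inj[of n p] p \<open>p \<noteq> n\<close> n by auto
  have "\<pi> n < \<pi> (Suc n)"
    using no_321[of p n "Suc n"] \<open>p < n\<close> x p pr inj[of n "Suc n"] by force
  then have "q \<noteq> n" "q \<noteq> Suc n" using q y by auto
  then have "q < n" using qr by auto
  have "q \<noteq> p" using p q by auto
  then consider "p < q" | "q < p" by linarith
  then show False
  proof cases
    case 1
    then show False using no_321[of p q "Suc n"] \<open>q < n\<close> p q y pr by auto
  next
    case 2
    then show False
      using no_3412[of q p n "Suc n"] \<open>p < n\<close> p q y qr \<open>\<pi> n < \<pi> (Suc n)\<close> by auto
  qed
qed

lemma tree_inversion_graph_Suc_iff:
  fixes n :: nat and \<pi> :: "nat \<Rightarrow> nat"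
  assumes \<pi>: "\<pi> permutes {1..Suc n}" and n: "1 \<le> n"
  shows "graph_tree (inversion_graph (Suc n) \<pi>) \<longleftrightarrow>
    (\<exists>\<sigma>. \<sigma> permutes {1..n} \<and> graph_tree (inversion_graph n \<sigma>) \<and>
      (\<pi> = \<sigma> \<circ> transpose n (Suc n) \<or> \<pi> = transpose n (Suc n) \<circ> \<sigma>))" (is "?L \<longleftrightarrow> ?R")
proof
  assume ?L
  let ?t = "transpose n (Suc n)"
  have t: "?t permutes {1..Suc n}" using n by (intro permutes_swap_id) auto
  have drop: "\<sigma> permutes {1..n}" if "\<sigma> permutes {1..Suc n}" "\<sigma> (Suc n) = Suc n" for \<sigma>
    by (rule permutes_superset[OF that(1)]) (use that(2) in \<open>auto simp: le_Suc_eq\<close>)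
  from tree_inversion_graph_max_near_end[OF \<pi> n \<open>?L\<close>] show ?R
  proof
    assume "\<pi> n = Suc n"
    then have "\<pi> \<circ> ?t permutes {1..n}" using drop permutes_compose[OF t \<pi>] by simp
    moreover have \<pi>_eq: "(\<pi> \<circ> ?t) \<circ> ?t = \<pi>" by (simp add: comp_assoc)
    ultimately have "graph_tree (inversion_graph n (\<pi> \<circ> ?t))"
      using graph_tree_comp_transpose_iff[of "\<pi> \<circ> ?t" n] n \<open>?L\<close> by (simp only:)
    with \<open>\<pi> \<circ> ?t permutes {1..n}\<close> \<pi>_eq[symmetric] show ?R by blast
  next
    assume "\<pi> (Suc n) = n"
    then have "?t \<circ> \<pi> permutes {1..n}" using drop permutes_compose[OF \<pi> t] by simp
    moreover have \<pi>_eq: "?t \<circ> (?t \<circ> \<pi>) = \<pi>" by (simp flip: comp_assoc)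
    ultimately have "graph_tree (inversion_graph n (?t \<circ> \<pi>))"
      using graph_tree_transpose_comp_iff[of "?t \<circ> \<pi>" n] n \<open>?L\<close> by (simp only:)
    with \<open>?t \<circ> \<pi> permutes {1..n}\<close> \<pi>_eq[symmetric] show ?R by blast
  qed
next
  assume ?R
  then show ?L using graph_tree_comp_transpose_iff graph_tree_transpose_comp_iff n by metis
qed

section \<open>Unimodal cycles\<close>

text \<open>
  Rotating the list does not change its cycle, so the list can be taken in its unimodal
  rotation.
\<close>

lemma unimodal_cycle_iff:
  "unimodal_cycle n \<pi> \<longleftrightarrow>
    (\<exists>cs. distinct cs \<and> set cs = {1..n} \<and> \<pi> = cycle_of_list cs \<and> unimodal cs)"
proof
  assume "unimodal_cycle n \<pi>"
  then obtain cs k where "distinct cs" "set cs = {1..n}" "\<pi> = cycle_of_list cs"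
    "unimodal (rotate k cs)" by (auto simp: unimodal_cycle_def)
  then show "\<exists>cs. distinct cs \<and> set cs = {1..n} \<and> \<pi> = cycle_of_list cs \<and> unimodal cs"
    using cycle_of_list_rotate_independent[of cs k] by (intro exI[of _ "rotate k cs"]) auto
next
  assume "\<exists>cs. distinct cs \<and> set cs = {1..n} \<and> \<pi> = cycle_of_list cs \<and> unimodal cs"
  then show "unimodal_cycle n \<pi>" unfolding unimodal_cycle_def by (metis rotate0 id_apply)
qed

lemma unimodal_cycle_permutes: "unimodal_cycle n \<pi> \<Longrightarrow> \<pi> permutes {1..n}"
  unfolding unimodal_cycle_iff using cycle_permutes by metis

text \<open>
  For \<open>us = []\<close> this is the recursive equation of \<open>cycle_of_list\<close>. The transposition of \<open>a\<close> and
  \<open>b\<close> is then moved to the left past the transpositions that the entries of \<open>us\<close> contribute: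
  it turns the one that joins the last entry of \<open>us\<close> to \<open>a\<close> into the one that joins it to \<open>b\<close>,
  and commutes with the others.
\<close>

lemma cycle_of_list_insert_before:
  assumes "distinct (us @ a # b # ds)"
  shows "cycle_of_list (us @ a # b # ds) = transpose a b \<circ> cycle_of_list (us @ b # ds)"
  using assms
proof (induction us rule: cycle_of_list.induct)
  case (1 u u' us)
  have "transpose u u' \<circ> transpose a b = transpose a b \<circ> transpose u u'"
    using 1(2) by (auto simp: fun_eq_iff transpose_def)
  with 1 show ?case by (simp add: fun_eq_iff)
next
  case ("2_2" u)
  then have "transpose u a \<circ> transpose a b = transpose a b \<circ> transpose u b"
    by (auto simp: fun_eq_iff transpose_def)
  then show ?case by (simp add: fun_eq_iff)
qed simp

text \<open>
  Conjugation with the transposition of \<open>a\<close> and \<open>b\<close> renames \<open>a\<close> to \<open>b\<close> in the shorter cycle, so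
  that the transposition can be moved from the left of \<open>cycle_of_list (us @ b # ds)\<close> to the
  right of \<open>cycle_of_list (us @ a # ds)\<close>.
\<close>

lemma cycle_of_list_insert_after:
  assumes "distinct (us @ a # b # ds)"
  shows "cycle_of_list (us @ a # b # ds) = cycle_of_list (us @ a # ds) \<circ> transpose a b"
proof -
  let ?t = "transpose a b"
  have "map ?t (us @ a # ds) = us @ b # ds"
    using assms by (auto intro!: map_idI simp: transpose_eq_iff)
  then have "cycle_of_list (us @ b # ds) = ?t \<circ> cycle_of_list (us @ a # ds) \<circ> inv ?t"
    using conjugation_of_cycle[of "us @ a # ds" ?t] assms by simp
  then show ?thesis
    using cycle_of_list_insert_before[OF assms] by (simp add: fun_eq_iff)
qed

lemma unimodal_interval_split:
  assumes "unimodal cs" "set cs = {1..n}"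
  obtains us ds where "cs = us @ n # ds" "sorted_wrt (<) us" "sorted_wrt (>) ds"
    "\<forall>v\<in>set us \<union> set ds. v < n"
proof -
  from assms(1) obtain us m ds where
    cs: "cs = us @ m # ds" "sorted_wrt (<) (us @ [m])" "sorted_wrt (>) (m # ds)"
    by (auto simp: unimodal_def)
  then have below: "\<forall>v\<in>set us \<union> set ds. v < m" by (auto simp: sorted_wrt_append)
  have "m \<in> {1..n}" using cs assms(2) by auto
  then have "n \<in> set cs" using assms(2) by auto
  then have "n \<in> set us \<union> set ds \<or> n = m" using cs by auto
  then have "m = n" using below \<open>m \<in> {1..n}\<close> by (metis UnE UnI1 UnI2 atLeastAtMost_iff leD)
  with cs below show ?thesis by (intro that[of us ds]) (auto simp: sorted_wrt_append)
qed

text \<open>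
  Around the maximum \<open>n + 1\<close> of a unimodal list, the next largest value \<open>n\<close> is the last entry of
  the increasing part or the first entry of the decreasing part. These two cases are the
  insertions of \<open>n + 1\<close> after and before \<open>n\<close>.
\<close>

lemma unimodal_cycle_Suc_iff:
  assumes n: "1 \<le> n"
  shows "unimodal_cycle (Suc n) \<pi> \<longleftrightarrow>
    (\<exists>\<sigma>. unimodal_cycle n \<sigma> \<and>
      (\<pi> = \<sigma> \<circ> transpose n (Suc n) \<or> \<pi> = transpose n (Suc n) \<circ> \<sigma>))" (is "?L \<longleftrightarrow> ?R")
proof
  assume ?L
  then obtain cs where "distinct cs" "set cs = {1..Suc n}" "\<pi> = cycle_of_list cs" "unimodal cs"
    unfolding unimodal_cycle_iff by blast
  then obtain us ds where dist: "distinct (us @ Suc n # ds)"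
    and set: "set (us @ Suc n # ds) = {1..Suc n}"
    and \<pi>: "\<pi> = cycle_of_list (us @ Suc n # ds)"
    and us: "sorted_wrt (<) us" and ds: "sorted_wrt (>) ds"
    by (auto elim: unimodal_interval_split)
  have bound: "v \<le> n" if "v \<in> set us \<union> set ds" for v
  proof -
    have "v \<in> {1..Suc n}" "v \<noteq> Suc n" using that set dist by auto
    then show ?thesis by simp
  qed
  have rest: "set us \<union> set ds = {1..n}"
  proof -
    have "insert (Suc n) (set us \<union> set ds) = insert (Suc n) {1..n}"
      using set by (simp add: atLeastAtMostSuc_conv)
    then show ?thesis using dist by (subst (asm) insert_ident) auto
  qed
  then have "n \<in> set us \<union> set ds" using n by auto
  then show ?R
  proof
    assume "n \<in> set us"
    then obtain us1 us2 where split: "us = us1 @ n # us2" by (auto simp: in_set_conv_decomp)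
    have "us2 = []"
      using us bound[of "hd us2"] unfolding split by (cases us2) (auto simp: sorted_wrt_append)
    with split have us_eq: "us = us1 @ [n]" by simp
    have "v < n" if "v \<in> set ds" for v
      using bound[of v] that dist us_eq by (auto simp: le_less)
    then have "unimodal (us1 @ n # ds)"
      using us ds unfolding unimodal_def us_eq by auto
    then have "unimodal_cycle n (cycle_of_list (us1 @ n # ds))"
      using dist rest us_eq unfolding unimodal_cycle_iff
      by (intro exI[of _ "us1 @ n # ds"]) auto
    moreover have "\<pi> = cycle_of_list (us1 @ n # ds) \<circ> transpose n (Suc n)"
      using \<pi> dist cycle_of_list_insert_after[of us1 n "Suc n" ds] us_eq by simp
    ultimately show ?R by blast
  next
    assume "n \<in> set ds"
    then obtain ds1 ds2 where split: "ds = ds1 @ n # ds2" by (auto simp: in_set_conv_decomp)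
    have "ds1 = []"
      using ds bound[of "hd ds1"] unfolding split by (cases ds1) (auto simp: sorted_wrt_append)
    with split have ds_eq: "ds = n # ds2" by simp
    have "v < n" if "v \<in> set us" for v
      using bound[of v] that dist ds_eq by (auto simp: le_less)
    then have "unimodal (us @ n # ds2)"
      using us ds unfolding unimodal_def ds_eq
      by (intro exI[of _ us] exI[of _ n] exI[of _ ds2]) (auto simp: sorted_wrt_append)
    then have "unimodal_cycle n (cycle_of_list (us @ n # ds2))"
      using dist rest ds_eq unfolding unimodal_cycle_iff
      by (intro exI[of _ "us @ n # ds2"]) auto
    moreover have "\<pi> = transpose n (Suc n) \<circ> cycle_of_list (us @ n # ds2)"
      using \<pi> dist cycle_of_list_insert_before[of us "Suc n" n ds2] ds_eq
      by (simp add: transpose_commute)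
    ultimately show ?R by blast
  qed
next
  assume ?R
  then obtain \<sigma> where "unimodal_cycle n \<sigma>"
    and \<pi>: "\<pi> = \<sigma> \<circ> transpose n (Suc n) \<or> \<pi> = transpose n (Suc n) \<circ> \<sigma>" by blast
  then obtain cs where "distinct cs" "set cs = {1..n}" "\<sigma> = cycle_of_list cs" "unimodal cs"
    unfolding unimodal_cycle_iff by blast
  then obtain us ds where dist: "distinct (us @ n # ds)" and set: "set (us @ n # ds) = {1..n}"
    and \<sigma>: "\<sigma> = cycle_of_list (us @ n # ds)"
    and us: "sorted_wrt (<) us" and ds: "sorted_wrt (>) ds"
    and below: "\<forall>v\<in>set us \<union> set ds. v < n"
    by (auto elim: unimodal_interval_split)
  have fresh: "Suc n \<notin> set us \<union> set ds"
  proof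
    assume "Suc n \<in> set us \<union> set ds"
    then have "Suc n < n" using below by blast
    then show False by simp
  qed
  have cyc: "unimodal_cycle (Suc n) (cycle_of_list cs)"
    if "unimodal cs" "distinct cs" "set cs = insert (Suc n) (set (us @ n # ds))" for cs
    unfolding unimodal_cycle_iff using that set by (intro exI[of _ cs]) auto
  from \<pi> show ?L
  proof
    assume \<pi>: "\<pi> = \<sigma> \<circ> transpose n (Suc n)"
    have d: "distinct (us @ n # Suc n # ds)" using dist fresh by auto
    have "unimodal (us @ n # Suc n # ds)"
      unfolding unimodal_def using us ds below
      by (intro exI[of _ "us @ [n]"] exI[of _ "Suc n"] exI[of _ ds])
        (auto simp: sorted_wrt_append less_Suc_eq)
    then show ?L using cyc[OF _ d] cycle_of_list_insert_after[OF d] \<pi> \<sigma> by auto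
  next
    assume \<pi>: "\<pi> = transpose n (Suc n) \<circ> \<sigma>"
    have d: "distinct (us @ Suc n # n # ds)" using dist fresh by auto
    have "unimodal (us @ Suc n # n # ds)"
      unfolding unimodal_def using us ds below
      by (intro exI[of _ us] exI[of _ "Suc n"] exI[of _ "n # ds"])
        (auto simp: sorted_wrt_append less_Suc_eq)
    then show ?L
      using cyc[OF _ d] cycle_of_list_insert_before[OF d] \<pi> \<sigma>
      by (auto simp: transpose_commute)
  qed
qed

theorem proposition5p2:
  fixes n :: nat and \<pi> :: "nat \<Rightarrow> nat"
  assumes "n \<ge> 1" and "\<pi> permutes {1..n}"
  shows "graph_tree (inversion_graph n \<pi>) \<longleftrightarrow> unimodal_cycle n \<pi>"
  using assms
proof (induction n arbitrary: \<pi> rule: nat_induct_at_least)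
  case base
  have "\<not> vertex_cycle (parcs (inversion_graph 1 \<pi>)) vs" for vs
    by (auto simp: vertex_cycle_def parcs_inversion_graph intro!: exI[of _ 0])
  then have "graph_tree (inversion_graph 1 \<pi>)"
    by (auto simp: graph_tree_iff pair_graph_inversion_graph)
  moreover have "unimodal_cycle 1 \<pi>"
  proof -
    have "\<pi> = cycle_of_list [1]" using base by (simp add: permutes_sing)
    moreover have "unimodal [1]"
      unfolding unimodal_def by (intro exI[of _ "[]"] exI[of _ 1]) simp
    ultimately show ?thesis unfolding unimodal_cycle_iff by (intro exI[of _ "[1]"]) auto
  qed
  ultimately show ?case by simp
next
  case (Suc n)
  then show ?case
    using tree_inversion_graph_Suc_iff[of \<pi> n] unimodal_cycle_Suc_iff[of n \<pi>]
      unimodal_cycle_permutes[of n] by blast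
qed

end
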